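(* Let $d, n$ be positive integers with $d \geq 2$ and $n \geq d$. Let $R = (r_{1}, \dots, r_{n}) \in \mathbf{R}^{n}$ with $r_{1} \geq \cdots \geq r_{n} \geq 0$. Then the set $\mathcal{N}_{0}(d; R)$ is nonempty if and only if \[ d\, r_{1} \leq \sum_{i=1}^{n} r_{i}. \] Moreover, if this inequality holds, then there exists a $d$-hypermatrix in $\mathcal{N}_{0}(d; R)$ having at most $n \cdot d!$ nonzero entries.
   Context: Write $\langle n \rangle = \{1, \dots, n\}$. A real $d$-hypermatrix of size $n$ is a function $A: \langle n \rangle^{d} \to \mathbf{R}$; its values $A(i_1,\dots,i_d)$ are its entries. $A$ is nonnegative if all entries are $\geq 0$; symmetric if $A(i_{\pi(1)}, \dots, i_{\pi(d)}) = A(i_{1}, \dots, i_{d})$ for all $(i_1,\dots,i_d)\in\langle n\rangle^d$ and all permutations $\pi$ of $\{1,\dots,d\}$; strongly off-diagonal if every entry $A(i_1,\dots,i_d)$ with $i_k = i_l$ for some $k \neq l$ equals $0$. The slice with respect to $i_1 = j$ is the collection of entries $A(j, i_2, \dots, i_d)$ with $i_2,\dots,i_d \in \langle n \rangle$. For $R=(r_1,\dots,r_n)$, $\mathcal{N}_{0}(d; R)$ denotes the set of strongly off-diagonal symmetric nonnegative $d$-hypermatrices of size $n$ such that for each $j \in \langle n \rangle$ the sum of all entries in the slice with respect to $i_1 = j$ equals $r_j$, i.e. $\sum_{i_2,\dots,i_d \in \langle n\rangle} A(j,i_2,\dots,i_d) = r_j$. *)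

theory Defs
  imports Complex_Main "HOL-Library.FuncSet" "HOL-Combinatorics.Permutations"
begin

definition index_tuples :: "nat \<Rightarrow> nat \<Rightarrow> nat list set" where
  "index_tuples d n = {is. length is = d \<and> set is \<subseteq> {1..n}}"

text \<open>Being extensional, a hypermatrix is \<^const>\<open>undefined\<close> outside its index tuples.\<close>

definition hypermatrices :: "nat \<Rightarrow> nat \<Rightarrow> (nat list \<Rightarrow> real) set" where
  "hypermatrices d n = index_tuples d n \<rightarrow>\<^sub>E UNIV"

definition nonneg_hypermatrix :: "nat \<Rightarrow> nat \<Rightarrow> (nat list \<Rightarrow> real) \<Rightarrow> bool" where
  "nonneg_hypermatrix d n A \<longleftrightarrow> (\<forall>is \<in> index_tuples d n. 0 \<le> A is)"

text \<open>List positions are counted from 0, so permutations of the \<open>d\<close> positions permute \<open>{..<d}\<close>.\<close>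

definition symmetric_hypermatrix :: "nat \<Rightarrow> nat \<Rightarrow> (nat list \<Rightarrow> real) \<Rightarrow> bool" where
  "symmetric_hypermatrix d n A \<longleftrightarrow>
    (\<forall>is \<in> index_tuples d n. \<forall>\<pi>. \<pi> permutes {..<d} \<longrightarrow> A (permute_list \<pi> is) = A is)"

definition strongly_off_diagonal :: "nat \<Rightarrow> nat \<Rightarrow> (nat list \<Rightarrow> real) \<Rightarrow> bool" where
  "strongly_off_diagonal d n A \<longleftrightarrow>
    (\<forall>is \<in> index_tuples d n. (\<exists>k<d. \<exists>l<d. k \<noteq> l \<and> is ! k = is ! l) \<longrightarrow> A is = 0)"

definition slice_sum :: "nat \<Rightarrow> nat \<Rightarrow> (nat list \<Rightarrow> real) \<Rightarrow> nat \<Rightarrow> real" where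
  "slice_sum d n A j = (\<Sum>is \<in> index_tuples (d - 1) n. A (j # is))"

definition N0 :: "nat \<Rightarrow> nat \<Rightarrow> (nat \<Rightarrow> real) \<Rightarrow> (nat list \<Rightarrow> real) set" where
  "N0 d n r = {A \<in> hypermatrices d n.
     strongly_off_diagonal d n A \<and> symmetric_hypermatrix d n A \<and> nonneg_hypermatrix d n A \<and>
     (\<forall>j \<in> {1..n}. slice_sum d n A j = r j)}"

definition nonzero_positions :: "nat \<Rightarrow> nat \<Rightarrow> (nat list \<Rightarrow> real) \<Rightarrow> nat list set" where
  "nonzero_positions d n A = {is \<in> index_tuples d n. A is \<noteq> 0}"

end

theory Submission
  imports Defs "HOL-Combinatorics.Multiset_Permutations"
begin

text \<open>
  Necessity: by symmetry, \<open>d r\<^sub>1\<close> counts every entry \<open>A(i\<^sub>1,\<dots>,i\<^sub>d)\<close> once for each position \<open>k\<close> with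
  \<open>i\<^sub>k = 1\<close>; since \<open>A\<close> is strongly off-diagonal, a nonzero entry is counted at most once.

  Sufficiency: a strongly off-diagonal symmetric hypermatrix is a weight function on the
  \<open>d\<close>-element subsets of \<open>{1..n}\<close>, and each subset accounts for \<open>d!\<close> entries. So it is enough to
  write a vector \<open>s\<close> with \<open>0 \<le> s j \<le> M\<close> and coordinate sum \<open>d M\<close> as a nonnegative combination of at
  most \<open>n\<close> indicator vectors of \<open>d\<close>-element sets. This is done greedily: choose a \<open>d\<close>-element set
  \<open>S\<close> containing all \<open>j\<close> with \<open>s j = M\<close> and only \<open>j\<close> with \<open>s j > 0\<close>, and subtract the largest
  multiple \<open>t\<close> of its indicator vector that preserves the bounds for \<open>M - t\<close>. Coordinates equal to
  \<open>0\<close> or to the upper bound stay so, and at least one further coordinate becomes such. The number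
  of coordinates strictly in between is never \<open>1\<close>, as the sum is a multiple of \<open>M\<close>; this saves the one
  step that would otherwise exceed the bound \<open>n\<close>.
\<close>

section \<open>Vectors as nonnegative combinations of indicator vectors of sets\<close>

definition sized_subsets :: "nat \<Rightarrow> 'a set \<Rightarrow> 'a set set" where
  "sized_subsets d V = {S. S \<subseteq> V \<and> card S = d}"

lemma finite_sized_subsets: "finite V \<Longrightarrow> finite (sized_subsets d V)"
  unfolding sized_subsets_def by simp

text \<open>If \<open>j\<close> were the only such coordinate, all others would be \<open>0\<close>
  or \<open>M\<close>, so \<open>s j\<close> would be an integer multiple of \<open>M\<close>
  strictly between \<open>0\<close> and \<open>M\<close>.\<close>

lemma card_strictly_between_neq_1:
  fixes s :: "'a \<Rightarrow> real"
  assumes V: "finite V" and bounds: "\<And>j. j \<in> V \<Longrightarrow> 0 \<le> s j \<and> s j \<le> M"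
    and sum: "sum s V = real d * M"
  shows "card {j \<in> V. 0 < s j \<and> s j < M} \<noteq> 1"
proof
  assume "card {j \<in> V. 0 < s j \<and> s j < M} = 1"
  then obtain j where j: "{j \<in> V. 0 < s j \<and> s j < M} = {j}"
    by (auto simp: card_1_singleton_iff)
  hence jV: "j \<in> V" "0 < s j" "s j < M" by auto
  have "sum s (V - {j}) = (\<Sum>i\<in>V - {j}. if s i = M then M else 0)"
  proof (rule sum.cong)
    fix i assume i: "i \<in> V - {j}"
    hence "i \<notin> {j \<in> V. 0 < s j \<and> s j < M}" using j by auto
    thus "s i = (if s i = M then M else 0)" using i bounds[of i] by auto
  qed simp
  also have "\<dots> = real (card {i \<in> V - {j}. s i = M}) * M"
    using V by (simp add: sum.If_cases Int_def)
  finally have "s j = (real d - real (card {i \<in> V - {j}. s i = M})) * M"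
    using sum sum.remove[OF V jV(1), of s] by (simp add: algebra_simps)
  also have "\<dots> = real_of_int (int d - int (card {i \<in> V - {j}. s i = M})) * M"
    by simp
  finally obtain k :: int where k: "s j = real_of_int k * M" by blast
  have M: "M > 0" using jV by simp
  have "0 < k" using jV(2) M unfolding k by (simp add: zero_less_mult_iff)
  moreover have "k < 1" using jV(3) M unfolding k by simp
  ultimately show False by simp
qed

text \<open>The coordinates equal to \<open>M\<close> sum to at most \<open>d * M\<close>, so there
  are at most \<open>d\<close> of them. The positive ones carry the whole sum with at most
  \<open>M\<close> each, so there are at least \<open>d\<close>. A set of size \<open>d\<close> fits
  in between.\<close>

lemma ex_saturating_subset:
  fixes s :: "'a \<Rightarrow> real"
  assumes V: "finite V" and bounds: "\<And>j. j \<in> V \<Longrightarrow> 0 \<le> s j \<and> s j \<le> M"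
    and sum: "sum s V = real d * M" and M: "M > 0"
  obtains S where "{j \<in> V. s j = M} \<subseteq> S" "S \<subseteq> {j \<in> V. 0 < s j}" "card S = d"
proof -
  have "real (card {j \<in> V. s j = M}) * M = sum s {j \<in> V. s j = M}" by simp
  also have "\<dots> \<le> sum s V" using V bounds by (intro sum_mono2) auto
  finally have 1: "card {j \<in> V. s j = M} \<le> d" using sum M by simp
  have "sum s V = sum s {j \<in> V. 0 < s j}"
    using V bounds by (intro sum.mono_neutral_right) (auto simp: less_le)
  also have "\<dots> \<le> real (card {j \<in> V. 0 < s j}) * M"
    using bounds by (intro sum_bounded_above) auto
  finally have 2: "d \<le> card {j \<in> V. 0 < s j}" using sum M by simp
  have "\<exists>B. {j \<in> V. s j = M} \<subseteq> B \<and> B \<subseteq> {j \<in> V. 0 < s j} \<and> card B = d"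
    using 1 2 V M by (intro exists_subset_between) auto
  thus ?thesis using that by blast
qed

text \<open>Induction on the number of coordinates strictly between the bounds. The
  \<open>max 1\<close> covers the case \<open>M > 0\<close> with every coordinate \<open>0\<close>
  or \<open>M\<close>, where a single set is needed.\<close>

lemma ex_subset_weights:
  fixes s :: "'a \<Rightarrow> real" and M :: real
  assumes V: "finite V" and d: "d \<ge> 1"
    and bounds: "\<And>j. j \<in> V \<Longrightarrow> 0 \<le> s j \<and> s j \<le> M" and M: "0 \<le> M"
    and sum: "sum s V = real d * M"
  shows "\<exists>w :: 'a set \<Rightarrow> real. (\<forall>S. 0 \<le> w S)
     \<and> (\<forall>j\<in>V. (\<Sum>S\<in>{S \<in> sized_subsets d V. j \<in> S}. w S) = s j)
     \<and> card {S \<in> sized_subsets d V. w S \<noteq> 0}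
         \<le> (if M = 0 then 0 else max 1 (card {j \<in> V. 0 < s j \<and> s j < M}))"
  using bounds M sum
proof (induction "card {j \<in> V. 0 < s j \<and> s j < M}" arbitrary: s M rule: less_induct)
  case less
  note bounds = less.prems(1) and sum = less.prems(3)
  let ?act = "{j \<in> V. 0 < s j \<and> s j < M}"
  show ?case
  proof (cases "M = 0")
    case True
    thus ?thesis using bounds by (intro exI[of _ "\<lambda>_. 0"]) force
  next
    case False
    hence M: "M > 0" using less.prems by simp
    obtain S where S: "{j \<in> V. s j = M} \<subseteq> S" "S \<subseteq> {j \<in> V. 0 < s j}" "card S = d"
      using ex_saturating_subset[OF V bounds sum M] by blast
    hence SV: "S \<subseteq> V" "finite S" "S \<noteq> {}" using V d by (auto intro: finite_subset)
    \<comment> \<open>The largest \<open>t\<close> that coordinate \<open>j\<close> tolerates: on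
      \<open>S\<close> it decreases and must stay nonnegative, off \<open>S\<close> it is fixed
      while the upper bound falls to \<open>M - t\<close>.\<close>
    define slack where "slack j = (if j \<in> S then s j else M - s j)" for j
    define t where "t = Min (slack ` V)"
    have slack_pos: "slack j > 0" if "j \<in> V" for j
      using S bounds[OF that] that unfolding slack_def by (auto simp: less_le)
    have "t \<in> slack ` V" unfolding t_def using V SV by (intro Min_in) auto
    then obtain j0 where j0: "j0 \<in> V" "slack j0 = t" by auto
    have t: "t > 0" using j0 slack_pos by auto
    have t_le: "t \<le> slack j" if "j \<in> V" for j unfolding t_def using V that by simp
    define s' where "s' j = (if j \<in> S then s j - t else s j)" for j
    let ?act' = "{j \<in> V. 0 < s' j \<and> s' j < M - t}"
    have b': "0 \<le> s' j \<and> s' j \<le> M - t" if "j \<in> V" for j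
      using t_le[OF that] bounds[OF that] unfolding s'_def slack_def by (auto split: if_splits)
    have M': "0 \<le> M - t" using b'[OF j0(1)] by linarith
    have "sum s' V = sum s V - (\<Sum>j\<in>V. if j \<in> S then t else 0)"
      unfolding s'_def sum_subtractf[symmetric] by (intro sum.cong) auto
    also have "(\<Sum>j\<in>V. if j \<in> S then t else 0) = real d * t"
      using V SV S(3) by (simp add: sum.If_cases Int_absorb1)
    finally have sum': "sum s' V = real d * (M - t)" by (simp add: sum algebra_simps)
    have sub: "?act' \<subseteq> ?act" using t by (auto simp: s'_def split: if_splits)
    \<comment> \<open>The minimizer \<open>j0\<close> reaches \<open>0\<close> if it lies in
      \<open>S\<close>, and the new bound \<open>M - t\<close> otherwise. If \<open>t = M\<close>,
      there may be no strictly intermediate coordinate to lose, so that case avoids the induction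
      hypothesis: \<open>s'\<close> is then zero and needs no sets.\<close>
    have psub: "?act' \<subset> ?act" if "M - t \<noteq> 0"
    proof -
      have "j0 \<in> ?act" "j0 \<notin> ?act'"
        using j0 that M' t bounds[OF j0(1)] by (auto simp: slack_def s'_def split: if_splits)
      thus ?thesis using sub by blast
    qed
    have "\<exists>w :: 'a set \<Rightarrow> real. (\<forall>S. 0 \<le> w S)
     \<and> (\<forall>j\<in>V. (\<Sum>S\<in>{S \<in> sized_subsets d V. j \<in> S}. w S) = s' j)
     \<and> card {S \<in> sized_subsets d V. w S \<noteq> 0} \<le> (if M - t = 0 then 0 else max 1 (card ?act'))"
    proof (cases "M - t = 0")
      case True
      thus ?thesis using b' by (intro exI[of _ "\<lambda>_. 0"]) force
    next
      case False
      show ?thesis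
        by (rule less.hyps) (use b' M' sum' V psub[OF False] in \<open>auto intro: psubset_card_mono\<close>)
    qed
    then obtain w where w: "\<And>S. 0 \<le> w S"
       "\<And>j. j \<in> V \<Longrightarrow> (\<Sum>S\<in>{S \<in> sized_subsets d V. j \<in> S}. w S) = s' j"
       "card {S \<in> sized_subsets d V. w S \<noteq> 0} \<le> (if M - t = 0 then 0 else max 1 (card ?act'))"
      by blast
    have SD: "S \<in> sized_subsets d V" using S(3) SV by (simp add: sized_subsets_def)
    let ?w = "\<lambda>T. w T + (if T = S then t else 0)"
    have "(\<Sum>T\<in>{T \<in> sized_subsets d V. j \<in> T}. ?w T) = s j" if "j \<in> V" for j
      using w(2)[OF that] SD finite_sized_subsets[OF V, of d]
      by (simp add: sum.distrib s'_def)
    moreover have "card {T \<in> sized_subsets d V. ?w T \<noteq> 0} \<le> max 1 (card ?act)"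
    proof -
      have fin: "finite {T \<in> sized_subsets d V. w T \<noteq> 0}"
        using finite_sized_subsets[OF V, of d] by simp
      have "card {T \<in> sized_subsets d V. ?w T \<noteq> 0}
          \<le> card (insert S {T \<in> sized_subsets d V. w T \<noteq> 0})"
        using fin by (intro card_mono) auto
      also have "\<dots> \<le> Suc (card {T \<in> sized_subsets d V. w T \<noteq> 0})"
        by (rule card_insert_le_m1) auto
      finally have le: "card {T \<in> sized_subsets d V. ?w T \<noteq> 0}
          \<le> Suc (card {T \<in> sized_subsets d V. w T \<noteq> 0})" .
      show ?thesis
      proof (cases "M - t = 0")
        case True
        thus ?thesis using le w(3) by auto
      next
        case False
        \<comment> \<open>Together with \<open>card ?act \<noteq> 1\<close> this gives
          \<open>card ?act \<ge> 2\<close>, so the extra set \<open>S\<close> fits even when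
          \<open>max 1 (card ?act')\<close> is \<open>1\<close> because \<open>?act'\<close> is
          empty.\<close>
        have "card ?act' < card ?act" using psub[OF False] V by (intro psubset_card_mono) auto
        moreover have "card ?act \<noteq> 1" by (rule card_strictly_between_neq_1[OF V bounds sum])
        ultimately show ?thesis using le w(3) False by (auto split: if_splits)
      qed
    qed
    ultimately show ?thesis using False w(1) t
      by (intro exI[of _ ?w]) (auto simp: add_nonneg_nonneg)
  qed
qed

section \<open>Slice sums and the necessary inequality\<close>

lemma index_tuples_Suc:
  "index_tuples (Suc d) n = (\<lambda>(j, is). j # is) ` ({1..n} \<times> index_tuples d n)"
  by (auto simp: index_tuples_def length_Suc_conv image_iff)

lemma finite_index_tuples: "finite (index_tuples d n)"
  using finite_lists_length_eq[of "{1..n}" d] by (simp add: index_tuples_def conj_commute)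

lemma permute_list_index_tuples:
  assumes "p permutes {..<d}" "is \<in> index_tuples d n"
  shows "permute_list p is \<in> index_tuples d n"
  using assms by (auto simp: index_tuples_def)

lemma slice_sum_conv_position_0:
  assumes "j \<in> {1..n}" "d \<ge> 1"
  shows "slice_sum d n A j = (\<Sum>is\<in>{is \<in> index_tuples d n. is ! 0 = j}. A is)"
proof -
  obtain d' where d': "d = Suc d'" using assms by (cases d) auto
  have "{is \<in> index_tuples d n. is ! 0 = j} = (\<lambda>is. j # is) ` index_tuples d' n"
    using assms(1) unfolding d' index_tuples_Suc by auto
  thus ?thesis by (simp add: slice_sum_def d' sum.reindex)
qed

text \<open>Swapping positions \<open>0\<close> and \<open>k\<close> is an involution on index
  tuples that preserves the entries and turns a condition on one position into the same condition on
  the other.\<close>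

lemma slice_sum_conv_position:
  assumes A: "symmetric_hypermatrix d n A" and j: "j \<in> {1..n}" and k: "k < d"
  shows "slice_sum d n A j = (\<Sum>is\<in>{is \<in> index_tuples d n. is ! k = j}. A is)"
proof -
  let ?p = "Transposition.transpose 0 k"
  have p: "?p permutes {..<d}" using k by (intro permutes_swap_id) auto
  have nth: "permute_list ?p is ! i = is ! ?p i"
    if "is \<in> index_tuples d n" "i < d" for "is" i
    using that p by (auto simp: index_tuples_def intro!: permute_list_nth)
  have inv: "permute_list ?p (permute_list ?p is) = is" if "is \<in> index_tuples d n" for "is"
    using that p by (subst permute_list_compose[symmetric]) (auto simp: index_tuples_def)
  have "(\<Sum>is\<in>{is \<in> index_tuples d n. is ! 0 = j}. A is)
      = (\<Sum>is\<in>{is \<in> index_tuples d n. is ! k = j}. A is)"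
    using p k A
    by (intro sum.reindex_bij_witness[of _ "permute_list ?p" "permute_list ?p"])
       (auto simp: inv nth permute_list_index_tuples symmetric_hypermatrix_def)
  thus ?thesis using slice_sum_conv_position_0[OF j] k by simp
qed

lemma sum_slice_sums:
  assumes "d \<ge> 1"
  shows "(\<Sum>j=1..n. slice_sum d n A j) = sum A (index_tuples d n)"
proof -
  obtain d' where d': "d = Suc d'" using assms by (cases d) auto
  have "sum A (index_tuples d n) = (\<Sum>(j, is)\<in>{1..n} \<times> index_tuples d' n. A (j # is))"
    unfolding d' index_tuples_Suc by (subst sum.reindex) (auto simp: inj_on_def case_prod_unfold)
  thus ?thesis by (simp add: slice_sum_def d' sum.cartesian_product)
qed

lemma slice_sum_bound:
  assumes off: "strongly_off_diagonal d n A" and sym: "symmetric_hypermatrix d n A"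
    and nonneg: "nonneg_hypermatrix d n A" and j: "j \<in> {1..n}"
  shows "real d * slice_sum d n A j \<le> sum A (index_tuples d n)"
proof -
  have "real d * slice_sum d n A j = (\<Sum>k<d. slice_sum d n A j)" by simp
  also have "\<dots> = (\<Sum>k<d. \<Sum>is\<in>index_tuples d n. if is ! k = j then A is else 0)"
    using slice_sum_conv_position[OF sym j] finite_index_tuples
    by (intro sum.cong) (auto simp: sum.inter_filter)
  also have "\<dots> = (\<Sum>is\<in>index_tuples d n. \<Sum>k<d. if is ! k = j then A is else 0)"
    by (rule sum.swap)
  also have "\<dots> \<le> sum A (index_tuples d n)"
  proof (rule sum_mono)
    fix "is" assume I: "is \<in> index_tuples d n"
    have "(\<Sum>k<d. if is ! k = j then A is else 0) = real (card {k. k < d \<and> is ! k = j}) * A is"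
      by (simp add: sum.If_cases Int_def)
    also have "\<dots> \<le> A is"
    proof (cases "A is = 0")
      case False
      \<comment> \<open>Two positions carrying \<open>j\<close> would force the entry to
        vanish.\<close>
      hence "card {k. k < d \<and> is ! k = j} \<le> 1"
        using off I unfolding strongly_off_diagonal_def
        by (subst One_nat_def, subst card_le_Suc0_iff_eq) auto
      moreover have "0 \<le> A is" using nonneg I by (simp add: nonneg_hypermatrix_def)
      ultimately show ?thesis by (intro mult_left_le_one_le) auto
    qed simp
    finally show "(\<Sum>k<d. if is ! k = j then A is else 0) \<le> A is" .
  qed
  finally show ?thesis .
qed

section \<open>Hypermatrices from weights on sets\<close>

text \<open>Dependence on \<open>set is\<close> alone gives symmetry, the test
  \<open>distinct\<close> gives zeros at repeated indices, and \<open>restrict\<close> gives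
  extensionality.\<close>

definition subset_hypermatrix :: "nat \<Rightarrow> nat \<Rightarrow> (nat set \<Rightarrow> real) \<Rightarrow> nat list \<Rightarrow> real" where
  "subset_hypermatrix d n w =
     restrict (\<lambda>is. if distinct is then w (set is) else 0) (index_tuples d n)"

text \<open>The tails of the tuples in the slice are grouped by the set they form together with
  \<open>j\<close>; a set \<open>S\<close> arises from the \<open>(d - 1)!\<close> orderings of
  \<open>S - {j}\<close>.\<close>

lemma slice_sum_subset_hypermatrix:
  assumes d: "d \<ge> 1" and j: "j \<in> {1..n}"
  shows "slice_sum d n (subset_hypermatrix d n w) j =
    fact (d - 1) * (\<Sum>S\<in>{S \<in> sized_subsets d {1..n}. j \<in> S}. w S)"
proof -
  let ?I = "index_tuples (d - 1) n" and ?D = "{S \<in> sized_subsets d {1..n}. j \<in> S}"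
  let ?L = "{is \<in> ?I. distinct (j # is)}"
  have finL: "finite ?L" using finite_index_tuples by simp
  have "slice_sum d n (subset_hypermatrix d n w) j
      = (\<Sum>is\<in>?I. if distinct (j # is) then w (insert j (set is)) else 0)"
    unfolding slice_sum_def subset_hypermatrix_def using d j
    by (intro sum.cong) (auto simp: index_tuples_def)
  also have "\<dots> = (\<Sum>is\<in>?L. w (insert j (set is)))"
    by (rule sum.inter_filter[symmetric]) (rule finite_index_tuples)
  also have "(\<Sum>is\<in>?L. w (insert j (set is))) = (\<Sum>S\<in>?D. \<Sum>is\<in>{is \<in> ?L. insert j (set is) = S}. w (insert j (set is)))"
    using finite_sized_subsets[of "{1..n}" d] d j
    by (intro sum.group[OF finL, symmetric])
       (auto simp: index_tuples_def sized_subsets_def distinct_card card_insert_if)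
  also have "\<dots> = (\<Sum>S\<in>?D. fact (d - 1) * w S)"
  proof (rule sum.cong)
    fix S assume S: "S \<in> ?D"
    hence fin: "finite S" by (auto simp: sized_subsets_def intro: finite_subset)
    have card: "card (S - {j}) = d - 1" using S by (simp add: sized_subsets_def)
    have "{is \<in> ?L. insert j (set is) = S} = permutations_of_set (S - {j})"
      using S card unfolding permutations_of_set_def
      by (auto simp: index_tuples_def sized_subsets_def distinct_card[symmetric])
    hence "card {is \<in> ?L. insert j (set is) = S} = fact (d - 1)" using card fin by simp
    moreover have "(\<Sum>is\<in>{is \<in> ?L. insert j (set is) = S}. w (insert j (set is)))
        = (\<Sum>is\<in>{is \<in> ?L. insert j (set is) = S}. w S)"
      by (rule sum.cong) auto
    ultimately show "(\<Sum>is\<in>{is \<in> ?L. insert j (set is) = S}. w (insert j (set is)))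
        = fact (d - 1) * w S"
      by simp
  qed simp
  finally show ?thesis by (simp add: sum_distrib_left)
qed

lemma subset_hypermatrix_in_N0:
  assumes d: "d \<ge> 1" and w: "\<And>S. 0 \<le> w S"
    and r: "\<And>j. j \<in> {1..n} \<Longrightarrow>
      fact (d - 1) * (\<Sum>S\<in>{S \<in> sized_subsets d {1..n}. j \<in> S}. w S) = r j"
  shows "subset_hypermatrix d n w \<in> N0 d n r"
proof -
  let ?A = "subset_hypermatrix d n w"
  have "?A \<in> hypermatrices d n" by (simp add: hypermatrices_def subset_hypermatrix_def)
  moreover have "strongly_off_diagonal d n ?A"
    by (auto simp: strongly_off_diagonal_def subset_hypermatrix_def index_tuples_def distinct_conv_nth)
  moreover have "symmetric_hypermatrix d n ?A"
    unfolding symmetric_hypermatrix_def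
  proof (intro ballI allI impI)
    fix "is" p assume I: "is \<in> index_tuples d n" and p: "p permutes {..<d}"
    hence "p permutes {..<length is}" by (simp add: index_tuples_def)
    thus "?A (permute_list p is) = ?A is"
      using I permute_list_index_tuples[OF p I] by (simp add: subset_hypermatrix_def)
  qed
  moreover have "nonneg_hypermatrix d n ?A"
    using w by (simp add: nonneg_hypermatrix_def subset_hypermatrix_def)
  ultimately show ?thesis
    using slice_sum_subset_hypermatrix[OF d] r by (simp add: N0_def)
qed

text \<open>Every nonzero position is one of the \<open>d!\<close> orderings of a set of nonzero
  weight.\<close>

lemma card_nonzero_positions_subset_hypermatrix:
  "card (nonzero_positions d n (subset_hypermatrix d n w))
     \<le> card {S \<in> sized_subsets d {1..n}. w S \<noteq> 0} * fact d"
proof -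
  let ?D = "{S \<in> sized_subsets d {1..n}. w S \<noteq> 0}"
  have fin: "finite ?D" using finite_sized_subsets[of "{1..n}" d] by simp
  have "nonzero_positions d n (subset_hypermatrix d n w) \<subseteq> (\<Union>S\<in>?D. permutations_of_set S)"
    by (auto simp: nonzero_positions_def subset_hypermatrix_def index_tuples_def
        sized_subsets_def permutations_of_set_def distinct_card split: if_splits)
  hence "card (nonzero_positions d n (subset_hypermatrix d n w))
      \<le> card (\<Union>S\<in>?D. permutations_of_set S)"
    using fin by (intro card_mono) auto
  also have "\<dots> \<le> (\<Sum>S\<in>?D. card (permutations_of_set S))"
    by (rule card_UN_le[OF fin])
  also have "\<dots> = (\<Sum>S\<in>?D. fact d)"
  proof (rule sum.cong)
    fix S assume "S \<in> ?D"
    hence "finite S" "card S = d" by (auto simp: sized_subsets_def intro: finite_subset)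
    thus "card (permutations_of_set S) = fact d" by simp
  qed simp
  finally show ?thesis by simp
qed

theorem theorem4p1:
  fixes d n :: nat and r :: "nat \<Rightarrow> real"
  assumes "d \<ge> 2" and "n \<ge> d"
    and "\<And>i j. 1 \<le> i \<Longrightarrow> i \<le> j \<Longrightarrow> j \<le> n \<Longrightarrow> r j \<le> r i"
    and "r n \<ge> 0"
  shows "(N0 d n r \<noteq> {} \<longleftrightarrow> real d * r 1 \<le> (\<Sum>i=1..n. r i)) \<and>
    (real d * r 1 \<le> (\<Sum>i=1..n. r i) \<longrightarrow>
      (\<exists>A \<in> N0 d n r. card (nonzero_positions d n A) \<le> n * fact d))"
proof -
  have necessary: "real d * r 1 \<le> (\<Sum>i=1..n. r i)" if "A \<in> N0 d n r" for A
  proof -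
    have A: "strongly_off_diagonal d n A" "symmetric_hypermatrix d n A" "nonneg_hypermatrix d n A"
      and slice: "\<And>j. j \<in> {1..n} \<Longrightarrow> slice_sum d n A j = r j"
      using that by (auto simp: N0_def)
    have "1 \<in> {1..n}" using assms(1,2) by simp
    from slice_sum_bound[OF A this] slice[OF this]
    have "real d * r 1 \<le> sum A (index_tuples d n)" by simp
    also have "\<dots> = (\<Sum>j=1..n. slice_sum d n A j)"
      using sum_slice_sums[of d n A] assms(1) by simp
    also have "\<dots> = (\<Sum>i=1..n. r i)" using slice by (intro sum.cong) auto
    finally show ?thesis .
  qed
  have sufficient: "\<exists>A \<in> N0 d n r. card (nonzero_positions d n A) \<le> n * fact d"
    if le: "real d * r 1 \<le> (\<Sum>i=1..n. r i)"
  proof -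
    \<comment> \<open>The division cancels the factor \<open>(d - 1)!\<close> that slice sums pick
      up from orderings. The value of \<open>M\<close> is forced by the required sum
      \<open>d * M\<close>, and the assumed inequality becomes \<open>s 1 \<le> M\<close>.\<close>
    define s where "s j = r j / fact (d - 1)" for j
    define M where "M = sum s {1..n} / real d"
    have sum_s: "sum s {1..n} = (\<Sum>i=1..n. r i) / fact (d - 1)"
      by (simp add: s_def sum_divide_distrib)
    have bounds: "0 \<le> s j \<and> s j \<le> M" if "j \<in> {1..n}" for j
    proof
      have "r n \<le> r j" using that assms(3) by simp
      thus "0 \<le> s j" using assms(4) by (simp add: s_def)
      have "real d * r j \<le> real d * r 1" using that assms(3)[of 1 j] by (intro mult_left_mono) auto
      with le have "real d * r j \<le> (\<Sum>i=1..n. r i)" by linarith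
      hence "r j \<le> (\<Sum>i=1..n. r i) / real d" using assms(1) by (simp add: field_simps)
      hence "s j \<le> (\<Sum>i=1..n. r i) / real d / fact (d - 1)"
        unfolding s_def by (intro divide_right_mono) auto
      thus "s j \<le> M" unfolding M_def sum_s by (simp add: mult.commute)
    qed
    have M: "0 \<le> M" using bounds[of n] assms(1,2) by force
    have "sum s {1..n} = real d * M" using assms(1) by (simp add: M_def)
    moreover have "d \<ge> 1" using assms(1) by simp
    ultimately obtain w where w: "\<And>S. 0 \<le> w S"
      "\<And>j. j \<in> {1..n} \<Longrightarrow> (\<Sum>S\<in>{S \<in> sized_subsets d {1..n}. j \<in> S}. w S) = s j"
      "card {S \<in> sized_subsets d {1..n}. w S \<noteq> 0}
         \<le> (if M = 0 then 0 else max 1 (card {j \<in> {1..n}. 0 < s j \<and> s j < M}))"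
      using ex_subset_weights[of "{1..n}" d s M, OF finite_atLeastAtMost _ bounds M] by blast
    have "card {j \<in> {1..n}. 0 < s j \<and> s j < M} \<le> card {1..n}" by (intro card_mono) auto
    \<comment> \<open>The \<open>max 1\<close> does no harm, as \<open>n \<ge> 1\<close>.\<close>
    hence "card {S \<in> sized_subsets d {1..n}. w S \<noteq> 0} \<le> n"
      using w(3) assms(1,2) by (auto split: if_splits)
    hence "card (nonzero_positions d n (subset_hypermatrix d n w)) \<le> n * fact d"
      using card_nonzero_positions_subset_hypermatrix[of d n w] by (meson le_trans mult_le_mono1)
    moreover have "subset_hypermatrix d n w \<in> N0 d n r"
      using assms(1) w by (intro subset_hypermatrix_in_N0) (auto simp: s_def)
    ultimately show ?thesis by blast
  qed
  show ?thesis using necessary sufficient by blast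
qed

end
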